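(* Let $P$ be a finite set and $\mathcal{T}\subseteq 2^P$ a set system whose union is $P$ and which satisfies the complement condition. Then for every $(S^*,\mathcal{U}^* )\in\mathcal{C}^*$ there exists a cost function $c:\mathcal{T}\to\mathbb{R}_{\ge0}$ such that the family $\mathcal{C}^{\mathrm{simple}}\setminus\{(S^*,\mathcal{U}^* )\}$ does not determine the happy nucleolus of the set covering instance $(P,\mathcal{T},c)$.
   Context: A set covering instance $(P,\mathcal{T},c)$ consists of a finite set $P$, a family $\mathcal{T}$ of subsets of $P$ whose union is $P$, and costs $c:\mathcal{T}\to\mathbb{R}_{\ge 0}$. For $\mathcal{U}\subseteq\mathcal{T}$ write $c(\mathcal{U})=\sum_{T\in\mathcal{U}}c(T)$; $\mathcal{U}$ covers $S\subseteq P$ if every element of $S$ lies in some set of $\mathcal{U}$. For $y\in\mathbb{R}^P$ write $y(S)=\sum_{p\in S}y_p$. A coalition is a nonempty subset of $P$. Let $\mathcal{C}$ be the set of pairs $(S,\mathcal{U})$ with $\emptyset\ne S\subseteq P$, $\mathcal{U}\subseteq\mathcal{T}$ covering $S$; $\mathcal{C}^{\mathrm{simple}}=\{(S,\mathcal{U})\in\mathcal{C}:|\mathcal{U}|=1\}$; and $\mathcal{C}^*=\{(S,\{T\}): T\in\mathcal{T},\ S\notin\{\emptyset,P\},\ S=T\text{ or }S=T\setminus\{p\}\text{ for some }p\in T\}$. For $y\in\mathbb{R}^P_{\ge0}$, $\theta^y(S,\mathcal{U})=c(\mathcal{U})-y(S)$; $\theta^y(S)=\min\{\theta^y(S,\mathcal{U}):\mathcal{U}\subseteq\mathcal{T}\text{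 covers }S\}$; the excess vector $\theta^y$ lists $\theta^y(S)$ over all coalitions in nondecreasing order; for $\mathcal{C}'\subseteq\mathcal{C}$, $\theta^y[\mathcal{C}']$ lists $\theta^y(S,\mathcal{U})$ for $(S,\mathcal{U})\in\mathcal{C}'$ in nondecreasing order. $\mathrm{LP}(P,\mathcal{T},c)=\min\{\sum_{T}c(T)x_T: x\in\mathbb{R}^{\mathcal{T}}_{\ge0},\ \sum_{T\ni p}x_T\ge1\ \forall p\in P\}$. The happy nucleolus is the (unique) $y\in\mathbb{R}^P_{\ge0}$ with $y(P)=\mathrm{LP}(P,\mathcal{T},c)$ lexicographically maximizing $\theta^y$ among such vectors. A family $\mathcal{C}'\subseteq\mathcal{C}$ determines the happy nucleolus if the happy nucleolus is the unique vector lexicographically maximizing $\theta^y[\mathcal{C}']$ among all $y\in\mathbb{R}^P_{\ge0}$ with $y(P)=\mathrm{LP}(P,\mathcal{T},c)$. The set system $\mathcal{T}$ satisfies the complement condition if for every $T\in\mathcal{T}$ there exists $\mathcal{U}\subseteq\mathcal{T}\cap 2^{P\setminus T}$ that covers $P\setminus T$. *)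

theory Defs
  imports Complex_Main "HOL-Library.FuncSet" "HOL-Library.Multiset"
begin

definition set_system :: "'a set \<Rightarrow> 'a set set \<Rightarrow> bool" where
  "set_system P \<T> \<longleftrightarrow> finite P \<and> \<T> \<subseteq> Pow P \<and> \<Union>\<T> = P"

definition covers :: "'a set set \<Rightarrow> 'a set \<Rightarrow> bool" where
  "covers \<U> S \<longleftrightarrow> S \<subseteq> \<Union>\<U>"

definition complement_condition :: "'a set \<Rightarrow> 'a set set \<Rightarrow> bool" where
  "complement_condition P \<T> \<longleftrightarrow>
     (\<forall>T\<in>\<T>. \<exists>\<U>. \<U> \<subseteq> \<T> \<inter> Pow (P - T) \<and> covers \<U> (P - T))"

text \<open>A cost function is a function on all sets, but only its values on \<open>\<T>\<close> are ever
  constrained or used.\<close>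

definition set_covering_instance :: "'a set \<Rightarrow> 'a set set \<Rightarrow> ('a set \<Rightarrow> real) \<Rightarrow> bool" where
  "set_covering_instance P \<T> c \<longleftrightarrow> set_system P \<T> \<and> (\<forall>T\<in>\<T>. 0 \<le> c T)"

definition coalitions :: "'a set \<Rightarrow> 'a set set" where
  "coalitions P = Pow P - {{}}"

definition cover_pairs :: "'a set \<Rightarrow> 'a set set \<Rightarrow> ('a set \<times> 'a set set) set" where
  "cover_pairs P \<T> = {(S, \<U>). S \<in> coalitions P \<and> \<U> \<subseteq> \<T> \<and> covers \<U> S}"

definition simple_pairs :: "'a set \<Rightarrow> 'a set set \<Rightarrow> ('a set \<times> 'a set set) set" where
  "simple_pairs P \<T> = {(S, \<U>) \<in> cover_pairs P \<T>. card \<U> = 1}"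

definition star_pairs :: "'a set \<Rightarrow> 'a set set \<Rightarrow> ('a set \<times> 'a set set) set" where
  "star_pairs P \<T> =
     {(S, {T}) | S T. T \<in> \<T> \<and> S \<notin> {{}, P} \<and> (S = T \<or> (\<exists>p\<in>T. S = T - {p}))}"

definition pair_excess ::
    "('a set \<Rightarrow> real) \<Rightarrow> ('a \<Rightarrow> real) \<Rightarrow> 'a set \<times> 'a set set \<Rightarrow> real" where
  "pair_excess c y = (\<lambda>(S, \<U>). sum c \<U> - sum y S)"

definition excess ::
    "'a set set \<Rightarrow> ('a set \<Rightarrow> real) \<Rightarrow> ('a \<Rightarrow> real) \<Rightarrow> 'a set \<Rightarrow> real" where
  "excess \<T> c y S = Min {pair_excess c y (S, \<U>) | \<U>. \<U> \<subseteq> \<T> \<and> covers \<U> S}"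

definition sorted_values :: "('b \<Rightarrow> real) \<Rightarrow> 'b set \<Rightarrow> real list" where
  "sorted_values f A = sorted_list_of_multiset (image_mset f (mset_set A))"

definition excess_vector ::
    "'a set \<Rightarrow> 'a set set \<Rightarrow> ('a set \<Rightarrow> real) \<Rightarrow> ('a \<Rightarrow> real) \<Rightarrow> real list" where
  "excess_vector P \<T> c y = sorted_values (excess \<T> c y) (coalitions P)"

definition pair_excess_vector ::
    "('a set \<times> 'a set set) set \<Rightarrow> ('a set \<Rightarrow> real) \<Rightarrow> ('a \<Rightarrow> real) \<Rightarrow> real list" where
  "pair_excess_vector \<C> c y = sorted_values (pair_excess c y) \<C>"

text \<open>The infimum is attained: the linear program is feasible and its objective is bounded
  below by 0.\<close>

definition LP :: "'a set \<Rightarrow> 'a set set \<Rightarrow> ('a set \<Rightarrow> real) \<Rightarrow> real" where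
  "LP P \<T> c =
     Inf {\<Sum>T\<in>\<T>. c T * x T | x. x \<in> \<T> \<rightarrow> {0..} \<and> (\<forall>p\<in>P. 1 \<le> (\<Sum>T | T \<in> \<T> \<and> p \<in> T. x T))}"

text \<open>Vectors indexed by \<open>P\<close> are extensional functions, so that equality of vectors is
  equality of functions.\<close>

definition allocations :: "'a set \<Rightarrow> 'a set set \<Rightarrow> ('a set \<Rightarrow> real) \<Rightarrow> ('a \<Rightarrow> real) set" where
  "allocations P \<T> c = {y \<in> P \<rightarrow>\<^sub>E {0..}. sum y P = LP P \<T> c}"

text \<open>This is only used for functions \<open>\<theta>\<close> whose values are lists of one fixed length.\<close>

definition lex_maximizer :: "('b \<Rightarrow> real list) \<Rightarrow> 'b set \<Rightarrow> 'b \<Rightarrow> bool" where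
  "lex_maximizer \<theta> Y y \<longleftrightarrow> y \<in> Y \<and> (\<forall>z\<in>Y. lexordp_eq (\<theta> z) (\<theta> y))"

definition happy_nucleolus ::
    "'a set \<Rightarrow> 'a set set \<Rightarrow> ('a set \<Rightarrow> real) \<Rightarrow> ('a \<Rightarrow> real) \<Rightarrow> bool" where
  "happy_nucleolus P \<T> c y \<longleftrightarrow> lex_maximizer (excess_vector P \<T> c) (allocations P \<T> c) y"

text \<open>The happy nucleolus exists and is unique for every set covering instance; the
  existential quantifier merely names it.\<close>

definition determines_happy_nucleolus ::
    "'a set \<Rightarrow> 'a set set \<Rightarrow> ('a set \<Rightarrow> real) \<Rightarrow> ('a set \<times> 'a set set) set \<Rightarrow> bool" where
  "determines_happy_nucleolus P \<T> c \<C> \<longleftrightarrow>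
     (\<exists>y. happy_nucleolus P \<T> c y \<and>
          (\<forall>z. lex_maximizer (pair_excess_vector \<C> c) (allocations P \<T> c) z \<longleftrightarrow> z = y))"

end

theory Submission
  imports Defs
begin

text \<open>Let \<open>S\<close> be \<open>D\<close> or \<open>D - {p}\<close> with \<open>D \<in> \<T>\<close>. Let \<open>D\<close> cost 1, let a set disjoint from \<open>D\<close> cost
  the number of its elements in a fixed \<open>Q \<subseteq> P - D\<close>, and let all other sets be too expensive to
  matter. The complement condition makes this instance balanced with LP value \<open>1 + |Q|\<close>, so the
  happy nucleolus \<open>y\<close> lies in the core.

  If \<open>S = D\<close>, take \<open>Q = {q}\<close> for an element \<open>q\<close> covered only once by a minimal cover of \<open>P - D\<close>.
  Without the constraint of \<open>D\<close>, moving a small amount from \<open>P - D\<close> to \<open>D\<close> is a lexicographic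
  improvement, since some set containing \<open>q\<close> is tight at \<open>y\<close>.

  If \<open>S = D - {p}\<close>, take \<open>Q = {}\<close>. Then \<open>y\<close> is uniform on \<open>D\<close>, because \<open>D - {r}\<close> has excess \<open>y r\<close>;
  without the constraint of \<open>D - {p}\<close> it is better to lower \<open>y p\<close> to 0.\<close>

subsection \<open>Lexicographic comparison of sorted lists\<close>

lemma sort_Cons_least:
  fixes x :: "'a::linorder"
  assumes "\<And>y. y \<in> set xs \<Longrightarrow> x \<le> y"
  shows "sort (x # xs) = x # sort xs"
  using assms by (auto intro: insort_is_Cons)

lemma sort_lexordp_common_part:
  fixes xs ys zs :: "'a::linorder list"
  assumes "sorted xs" "\<And>x. x \<in> set xs \<Longrightarrow> x \<le> m" "\<And>z. z \<in> set zs \<Longrightarrow> m \<le> z"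
    and "b \<in> set ys" "b < m" "zs \<noteq> []"
  shows "ord_class.lexordp (sort (xs @ ys)) (sort (xs @ zs))"
  using assms
proof (induction xs)
  case Nil
  obtain y ys' where y: "sort ys = y # ys'"
    using Nil(4) by (metis empty_iff empty_set list.exhaust set_sort)
  obtain z zs' where z: "sort zs = z # zs'"
    using Nil(6) by (metis empty_set list.exhaust set_empty set_sort)
  have "y \<le> b"
    using sorted_sort[of ys] Nil(4) set_sort[where xs = ys and f = "\<lambda>x. x"] unfolding y by auto
  moreover have "m \<le> z"
    using Nil(3)[of z] set_sort[where xs = zs and f = "\<lambda>x. x"] unfolding z by auto
  ultimately show ?case
    using Nil(5) by (auto simp: y z)
next
  case (Cons x xs)
  have z: "sort ((x # xs) @ zs) = x # sort (xs @ zs)"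
    using Cons.prems unfolding append_Cons by (intro sort_Cons_least) (auto dest: order_trans)
  show ?case
  proof (cases "\<forall>y\<in>set ys. x \<le> y")
    case True
    then have "sort ((x # xs) @ ys) = x # sort (xs @ ys)"
      using Cons.prems unfolding append_Cons by (intro sort_Cons_least) auto
    moreover have "ord_class.lexordp (sort (xs @ ys)) (sort (xs @ zs))"
      using Cons by simp
    ultimately show ?thesis
      using z by (metis lexordp_simps(3) order.irrefl)
  next
    case False
    then obtain y where y: "y \<in> set ys" "y < x" by auto
    obtain u us where u: "sort ((x # xs) @ ys) = u # us"
      by (metis append_Cons list.exhaust list.discI set_empty set_sort)
    have "u \<le> y"
      using sorted_sort[of "(x # xs) @ ys"] y(1)
        set_sort[where xs = "(x # xs) @ ys" and f = "\<lambda>x. x"] unfolding u by auto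
    then show ?thesis
      using y(2) unfolding u z by auto
  qed
qed

lemma sorted_values_conv_sort:
  assumes "distinct as"
  shows "sorted_values f (set as) = sort (map f as)"
  unfolding sorted_values_def mset_set_set[OF assms] mset_map[symmetric]
  by (rule sorted_list_of_multiset_mset)

text \<open>Otherwise \<open>z\<close> would beat \<open>y\<close>: on \<open>Z\<close> the two have
  the same entries, none above \<open>m\<close>, and off \<open>Z\<close> only \<open>y\<close> has
  an entry below \<open>m\<close>. Lexicographic optimality is exploited below through this lemma,
  with a suitable competitor \<open>z\<close>.\<close>

lemma lex_maximizer_sorted_values_ge:
  assumes max: "lex_maximizer (\<lambda>y. sorted_values (f y) A) Y y"
    and "z \<in> Y" "finite A" "Z \<subseteq> A"
    and Z: "\<And>a. a \<in> Z \<Longrightarrow> f y a = f z a \<and> f z a \<le> m"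
    and ge: "\<And>a. a \<in> A - Z \<Longrightarrow> m \<le> f z a"
    and "a \<in> A - Z"
  shows "m \<le> f y a"
proof (rule ccontr)
  assume "\<not> m \<le> f y a"
  obtain as where as: "set as = Z" "distinct as"
    using finite_distinct_list \<open>finite A\<close> \<open>Z \<subseteq> A\<close> finite_subset by metis
  obtain bs where bs: "set bs = A - Z" "distinct bs"
    using finite_distinct_list[of "A - Z"] \<open>finite A\<close> by auto
  \<comment> \<open>The inner \<open>sort\<close> brings the entries from \<open>Z\<close> into the
    sorted form that \<open>sort_lexordp_common_part\<close> requires.\<close>
  have sv: "sorted_values g A = sort (sort (map g as) @ map g bs)" for g
  proof -
    have "A = set (as @ bs)" "distinct (as @ bs)"
      using as bs \<open>Z \<subseteq> A\<close> by auto
    then have "sorted_values g A = sort (map g (as @ bs))"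
      using sorted_values_conv_sort by metis
    then show ?thesis
      by (metis map_append mset_append mset_sort sorted_list_of_multiset_mset)
  qed
  have "map (f y) as = map (f z) as"
    using as Z by simp
  moreover have "ord_class.lexordp (sort (sort (map (f z) as) @ map (f y) bs))
      (sort (sort (map (f z) as) @ map (f z) bs))"
    using as bs Z ge \<open>a \<in> A - Z\<close> \<open>\<not> m \<le> f y a\<close>
    by (intro sort_lexordp_common_part[where m = m and b = "f y a"]) auto
  ultimately have "ord_class.lexordp (sorted_values (f y) A) (sorted_values (f z) A)"
    by (simp only: sv)
  then show False
    using max \<open>z \<in> Y\<close> unfolding lex_maximizer_def
    by (simp add: lexordp_conv_lexordp_eq)
qed

subsection \<open>Set covering instances\<close>

lemma sum_le_sum_cover:
  fixes y :: "'a \<Rightarrow> real"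
  assumes "finite \<U>" "\<And>T. T \<in> \<U> \<Longrightarrow> finite T" "covers \<U> S"
    and nonneg: "\<And>T p. T \<in> \<U> \<Longrightarrow> p \<in> T \<Longrightarrow> 0 \<le> y p"
  shows "sum y S \<le> (\<Sum>T\<in>\<U>. sum y T)"
proof -
  have "sum y S \<le> sum y (\<Union>\<U>)"
    using assms by (intro sum_mono2) (auto simp: covers_def)
  also have "\<dots> \<le> (\<Sum>T\<in>\<U>. sum y T)"
    using assms(1,2) nonneg
  proof (induction \<U> rule: finite_induct)
    case (insert T \<U>)
    have "sum y (T \<union> \<Union>\<U>) + sum y (T \<inter> \<Union>\<U>) = sum y T + sum y (\<Union>\<U>)"
      using insert by (intro sum.union_inter) auto
    moreover have "0 \<le> sum y (T \<inter> \<Union>\<U>)"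
      using insert by (intro sum_nonneg) auto
    moreover have "sum y (\<Union>\<U>) \<le> (\<Sum>T\<in>\<U>. sum y T)"
      using insert by blast
    ultimately show ?case
      using insert.hyps by simp
  qed simp
  finally show ?thesis .
qed

text \<open>LP duality: \<open>w\<close> is feasible for the dual and the indicator of
  \<open>\<U>\<close> for the primal, with equal objective values, so both are optimal.\<close>

lemma LP_eqI:
  assumes "set_system P \<T>"
    and w: "\<And>p. p \<in> P \<Longrightarrow> 0 \<le> w p" "\<And>T. T \<in> \<T> \<Longrightarrow> sum w T \<le> c T"
    and \<U>: "\<U> \<subseteq> \<T>" "covers \<U> P" "sum c \<U> = sum w P"
  shows "LP P \<T> c = sum w P"
proof -
  have fin: "finite P" "finite \<T>" "\<And>T. T \<in> \<T> \<Longrightarrow> T \<subseteq> P"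
    using assms(1) by (auto simp: set_system_def dest: finite_subset)
  show ?thesis
    unfolding LP_def
  proof (rule cInf_eq_minimum)
    let ?x = "\<lambda>T. if T \<in> \<U> then 1 else 0 :: real"
    have "(\<Sum>T\<in>\<T>. c T * ?x T) = sum c \<U>"
      using \<U>(1) fin(2) by (simp add: sum.inter_restrict[symmetric] Int_absorb1 if_distrib cong: if_cong)
    moreover have "1 \<le> (\<Sum>T | T \<in> \<T> \<and> p \<in> T. ?x T)" if p: "p \<in> P" for p
    proof -
      obtain T where T: "T \<in> \<U>" "p \<in> T"
        using \<U>(2) p by (auto simp: covers_def)
      then have "(\<Sum>T\<in>{T}. ?x T) \<le> (\<Sum>T | T \<in> \<T> \<and> p \<in> T. ?x T)"
        using \<U>(1) fin(2) by (intro sum_mono2) auto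
      then show ?thesis using T by simp
    qed
    ultimately show "sum w P \<in> {\<Sum>T\<in>\<T>. c T * x T | x. x \<in> \<T> \<rightarrow> {0..} \<and>
        (\<forall>p\<in>P. 1 \<le> (\<Sum>T | T \<in> \<T> \<and> p \<in> T. x T))}"
      using \<U>(3) by (intro CollectI exI[of _ ?x]) auto
  next
    fix v
    assume "v \<in> {\<Sum>T\<in>\<T>. c T * x T | x. x \<in> \<T> \<rightarrow> {0..} \<and>
        (\<forall>p\<in>P. 1 \<le> (\<Sum>T | T \<in> \<T> \<and> p \<in> T. x T))}"
    then obtain x where v: "v = (\<Sum>T\<in>\<T>. c T * x T)" and x: "\<And>T. T \<in> \<T> \<Longrightarrow> 0 \<le> x T"
      and cov: "\<And>p. p \<in> P \<Longrightarrow> 1 \<le> (\<Sum>T | T \<in> \<T> \<and> p \<in> T. x T)"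
      by auto
    \<comment> \<open>Weak duality: the covering constraint of \<open>p\<close> is weighted by
      \<open>w p\<close>, and the double sum is then regrouped by sets.\<close>
    have "sum w P \<le> (\<Sum>p\<in>P. \<Sum>T | T \<in> \<T> \<and> p \<in> T. w p * x T)"
      unfolding sum_distrib_left[symmetric]
      using w(1) cov by (intro sum_mono) (metis mult.right_neutral mult_left_mono)
    also have "\<dots> = (\<Sum>T\<in>\<T>. \<Sum>p | p \<in> P \<and> p \<in> T. w p * x T)"
      by (rule sum.swap_restrict[OF fin(1,2)])
    also have "\<dots> = (\<Sum>T\<in>\<T>. sum w T * x T)"
    proof (rule sum.cong[OF refl])
      fix T assume "T \<in> \<T>"
      then have "{p. p \<in> P \<and> p \<in> T} = T" using fin(3) by auto
      then show "(\<Sum>p | p \<in> P \<and> p \<in> T. w p * x T) = sum w T * x T"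
        by (simp add: sum_distrib_right)
    qed
    also have "\<dots> \<le> v"
      unfolding v using w(2) x by (intro sum_mono mult_right_mono) auto
    finally show "sum w P \<le> v" .
  qed
qed

lemma excess_le:
  assumes "finite \<T>" "\<U> \<subseteq> \<T>" "covers \<U> S"
  shows "excess \<T> c y S \<le> sum c \<U> - sum y S"
proof -
  have "finite {pair_excess c y (S, \<U>) | \<U>. \<U> \<subseteq> \<T> \<and> covers \<U> S}"
    using assms(1) by simp
  then show ?thesis
    unfolding excess_def using assms(2,3) by (intro Min_le) (auto simp: pair_excess_def)
qed

lemma excess_ge:
  assumes "set_system P \<T>" "S \<subseteq> P"
    and "\<And>\<U>. \<U> \<subseteq> \<T> \<Longrightarrow> covers \<U> S \<Longrightarrow> m \<le> sum c \<U> - sum y S"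
  shows "m \<le> excess \<T> c y S"
proof -
  \<comment> \<open>The whole family covers \<open>S\<close>, so the minimum ranges over a nonempty
    set.\<close>
  have "finite \<T>" "covers \<T> S"
    using assms(1,2) by (auto simp: set_system_def covers_def dest: finite_subset)
  then have "finite {pair_excess c y (S, \<U>) | \<U>. \<U> \<subseteq> \<T> \<and> covers \<U> S}"
    "{pair_excess c y (S, \<U>) | \<U>. \<U> \<subseteq> \<T> \<and> covers \<U> S} \<noteq> {}"
    by auto
  then show ?thesis
    unfolding excess_def using assms(3) by (subst Min_ge_iff) (auto simp: pair_excess_def)
qed

lemma simple_pairs_eq:
  assumes "set_system P \<T>"
  shows "simple_pairs P \<T> = {(S, {T}) | S T. T \<in> \<T> \<and> S \<subseteq> T \<and> S \<noteq> {}}"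
  using assms
  by (auto simp: simple_pairs_def cover_pairs_def coalitions_def covers_def set_system_def
      card_1_singleton_iff)

lemma finite_simple_pairs:
  assumes "set_system P \<T>"
  shows "finite (simple_pairs P \<T>)"
proof (rule finite_subset)
  show "simple_pairs P \<T> \<subseteq> Pow P \<times> Pow \<T>"
    by (auto simp: simple_pairs_def cover_pairs_def coalitions_def)
  show "finite (Pow P \<times> Pow \<T>)"
    using assms by (auto simp: set_system_def dest: finite_subset)
qed

subsection \<open>A cost function for a set and its complement\<close>

text \<open>A cover \<open>\<W>\<close> of this kind comes from the complement condition. Since it
  covers \<open>Q\<close>, the last assumption says that each element of \<open>Q\<close> lies in
  exactly one set of \<open>\<W>\<close>; it makes \<open>\<W>\<close> cost exactly
  \<open>card Q\<close>.\<close>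

locale split_instance =
  fixes P :: "'a set" and \<T> :: "'a set set" and D Q :: "'a set" and \<W> :: "'a set set"
  assumes set_system: "set_system P \<T>"
    and D: "D \<in> \<T>" "D \<noteq> {}"
    and Q: "Q \<subseteq> P - D"
    and \<W>: "\<W> \<subseteq> \<T>" "\<And>T. T \<in> \<W> \<Longrightarrow> T \<inter> D = {}" "covers \<W> (P - D)"
    and sum_\<W>: "(\<Sum>T\<in>\<W>. card (T \<inter> Q)) = card Q"
begin

text \<open>The value \<open>card Q + 2\<close> exceeds the LP value by 1, so a pair using a set of
  this price has excess at least 1 for every allocation.\<close>

definition cost :: "'a set \<Rightarrow> real" where
  "cost T = (if T = D then 1 else if T \<inter> D = {} then real (card (T \<inter> Q)) else real (card Q) + 2)"

text \<open>An optimal dual solution of the covering LP. The value \<open>undefined\<close> off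
  \<open>P\<close> makes it extensional, as allocations have to be.\<close>

definition dual :: "'a \<Rightarrow> real" where
  "dual p = (if p \<in> D then 1 / card D else if p \<in> Q then 1 else if p \<in> P then 0 else undefined)"

lemma finite_P [simp]: "finite P" and finite_\<T> [simp]: "finite \<T>"
  and subset_P: "T \<in> \<T> \<Longrightarrow> T \<subseteq> P"
  using set_system by (auto simp: set_system_def dest: finite_subset)

lemma finite_\<W>: "finite \<W>"
  using \<W>(1) finite_\<T> by (rule finite_subset)

lemma finite_sub: "S \<subseteq> P \<Longrightarrow> finite S"
  using finite_P finite_subset by blast

lemma D_sub: "D \<subseteq> P" and finite_D [simp]: "finite D" and card_D: "0 < card D"
  using D subset_P finite_sub by (auto simp: card_gt_0_iff)

lemma cost_nonneg: "0 \<le> cost T"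
  by (simp add: cost_def)

lemma cost_D [simp]: "cost D = 1"
  by (simp add: cost_def)

lemma cost_disjoint: "T \<inter> D = {} \<Longrightarrow> cost T = card (T \<inter> Q)"
  using D by (auto simp: cost_def)

lemma cost_ge_1: "T \<inter> D \<noteq> {} \<Longrightarrow> 1 \<le> cost T"
  by (simp add: cost_def)

lemma covering_instance: "set_covering_instance P \<T> cost"
  using set_system cost_nonneg by (simp add: set_covering_instance_def)

lemma sum_cost_\<W>: "sum cost \<W> = card Q"
proof -
  have "sum cost \<W> = (\<Sum>T\<in>\<W>. real (card (T \<inter> Q)))"
    using \<W>(2) cost_disjoint by (intro sum.cong) auto
  then show ?thesis using sum_\<W> by (metis of_nat_sum)
qed

lemma sum_cost_insert_\<W>: "sum cost (insert D \<W>) = 1 + card Q"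
proof -
  have "D \<notin> \<W>" using D \<W>(2) by auto
  then show ?thesis using finite_\<W> sum_cost_\<W> by simp
qed

lemma covers_insert: "S \<subseteq> P \<Longrightarrow> covers (insert D \<W>) S"
  using \<W>(3) by (auto simp: covers_def)

lemma sum_split_D: "S \<subseteq> P \<Longrightarrow> sum y S = sum y (S \<inter> D) + sum y (S - D)"
  for y :: "'a \<Rightarrow> real"
  using finite_sub by (metis sum.Int_Diff)

lemma sum_dual:
  assumes "S \<subseteq> P"
  shows "sum dual S = card (S \<inter> D) / card D + card (S \<inter> Q)"
proof -
  have "sum dual (S - D) = (\<Sum>p\<in>S - D. if p \<in> Q then 1 else 0)"
    using assms by (intro sum.cong) (auto simp: dual_def)
  also have "\<dots> = (\<Sum>p\<in>(S - D) \<inter> Q. 1)"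
    using assms finite_sub by (subst sum.inter_restrict) auto
  also have "(S - D) \<inter> Q = S \<inter> Q"
    using Q by auto
  finally have "sum dual (S - D) = card (S \<inter> Q)"
    by simp
  moreover have "sum dual (S \<inter> D) = card (S \<inter> D) / card D"
    by (simp add: dual_def)
  ultimately show ?thesis
    using sum_split_D[OF assms, of dual] by simp
qed

lemma sum_dual_P: "sum dual P = 1 + card Q"
proof -
  have "P \<inter> D = D" "P \<inter> Q = Q"
    using D_sub Q by auto
  then show ?thesis
    using sum_dual[of P] D by simp
qed

lemma dual_nonneg: "p \<in> P \<Longrightarrow> 0 \<le> dual p"
  by (simp add: dual_def)

text \<open>Equality holds for \<open>D\<close> and for sets disjoint from \<open>D\<close>; any
  other set costs more than the total value of \<open>dual\<close>.\<close>

lemma sum_dual_le_cost: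
  assumes "T \<in> \<T>"
  shows "sum dual T \<le> cost T"
proof -
  have "sum dual T \<le> sum dual P"
    using subset_P[OF assms] dual_nonneg by (intro sum_mono2) auto
  moreover have "D \<inter> Q = {}"
    using Q by auto
  ultimately show ?thesis
    using sum_dual[OF subset_P[OF assms]] card_D
    by (auto simp: cost_def sum_dual_P)
qed

lemma LP_eq: "LP P \<T> cost = 1 + card Q"
proof -
  have "LP P \<T> cost = sum dual P"
  proof (rule LP_eqI)
    show "insert D \<W> \<subseteq> \<T>" using D \<W> by simp
    show "sum cost (insert D \<W>) = sum dual P"
      using sum_cost_insert_\<W> sum_dual_P by simp
  qed (use set_system dual_nonneg sum_dual_le_cost covers_insert in auto)
  then show ?thesis by (simp add: sum_dual_P)
qed

section \<open>Allocations and the core\<close>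

lemma allocations_iff:
  "y \<in> allocations P \<T> cost \<longleftrightarrow> y \<in> P \<rightarrow>\<^sub>E {0..} \<and> sum y P = 1 + card Q"
  by (simp add: allocations_def LP_eq)

lemma dual_allocation: "dual \<in> allocations P \<T> cost"
  using D_sub Q unfolding allocations_iff sum_dual_P
  by (auto simp: PiE_iff extensional_def dual_def)

text \<open>Only single sets are constrained; by subadditivity this already bounds every coalition
  with every cover.\<close>

definition core :: "('a \<Rightarrow> real) \<Rightarrow> bool" where
  "core y \<longleftrightarrow> y \<in> allocations P \<T> cost \<and> (\<forall>T\<in>\<T>. sum y T \<le> cost T)"

lemma core_dual: "core dual"
  using dual_allocation sum_dual_le_cost by (simp add: core_def)

lemma allocation_nonneg: "y \<in> allocations P \<T> cost \<Longrightarrow> p \<in> P \<Longrightarrow> 0 \<le> y p"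
  by (auto simp: allocations_iff PiE_iff)

lemma allocation_sum_mono:
  "y \<in> allocations P \<T> cost \<Longrightarrow> S \<subseteq> S' \<Longrightarrow> S' \<subseteq> P \<Longrightarrow> sum y S \<le> sum y S'"
  using allocation_nonneg finite_sub by (intro sum_mono2) auto

lemma allocation_sum_cover:
  assumes "y \<in> allocations P \<T> cost" "\<U> \<subseteq> \<T>" "covers \<U> S"
  shows "sum y S \<le> (\<Sum>T\<in>\<U>. sum y T)"
  using assms allocation_nonneg subset_P finite_sub finite_subset[OF assms(2) finite_\<T>]
  by (intro sum_le_sum_cover) (auto, blast+)

lemma core_excess_nonneg:
  assumes "core y" "S \<subseteq> P"
  shows "0 \<le> excess \<T> cost y S"
proof (rule excess_ge[OF set_system assms(2)])
  fix \<U> assume "\<U> \<subseteq> \<T>" "covers \<U> S"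
  then have "sum y S \<le> (\<Sum>T\<in>\<U>. sum y T)"
    using assms(1) allocation_sum_cover by (simp add: core_def)
  also have "\<dots> \<le> sum cost \<U>"
    using assms(1) \<open>\<U> \<subseteq> \<T>\<close> by (intro sum_mono) (auto simp: core_def)
  finally show "0 \<le> sum cost \<U> - sum y S" by simp
qed

lemma finite_coalitions: "finite (coalitions P)"
  by (simp add: coalitions_def)

text \<open>The competitor is \<open>dual\<close>, whose excesses are all nonnegative; with an empty
  common part and threshold 0, those of \<open>y\<close> are nonnegative too.\<close>

lemma happy_nucleolus_core:
  assumes "happy_nucleolus P \<T> cost y"
  shows "core y"
  unfolding core_def
proof (intro conjI ballI)
  have max: "lex_maximizer (\<lambda>y. sorted_values (excess \<T> cost y) (coalitions P))
      (allocations P \<T> cost) y"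
    using assms by (simp add: happy_nucleolus_def excess_vector_def[abs_def])
  show "y \<in> allocations P \<T> cost"
    using max by (simp add: lex_maximizer_def)
  fix T assume T: "T \<in> \<T>"
  show "sum y T \<le> cost T"
  proof (cases "T = {}")
    case False
    have "0 \<le> excess \<T> cost y T"
    proof (rule lex_maximizer_sorted_values_ge[OF max dual_allocation finite_coalitions])
      show "T \<in> coalitions P - {}"
        using T False subset_P by (auto simp: coalitions_def)
      show "0 \<le> excess \<T> cost dual S" if "S \<in> coalitions P - {}" for S
        using that core_excess_nonneg[OF core_dual] by (simp add: coalitions_def)
    qed auto
    also have "\<dots> \<le> sum cost {T} - sum y T"
      using T by (intro excess_le) (auto simp: covers_def)
    finally show ?thesis by simp
  qed (simp add: cost_nonneg)
qed

text \<open>The set \<open>D\<close> bounds the first sum by 1 and the cover \<open>\<W>\<close>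
  bounds the second by \<open>card Q\<close>. These bounds add up to the total value, so both are
  attained.\<close>

lemma core_sums:
  assumes "core y"
  shows "sum y D = 1" "sum y (P - D) = card Q"
proof -
  have y: "y \<in> allocations P \<T> cost" "\<And>T. T \<in> \<T> \<Longrightarrow> sum y T \<le> cost T"
    using assms by (auto simp: core_def)
  have "sum y (P - D) \<le> (\<Sum>T\<in>\<W>. sum y T)"
    using allocation_sum_cover y(1) \<W> by blast
  also have "\<dots> \<le> sum cost \<W>"
    using y(2) \<W>(1) by (intro sum_mono) auto
  finally have "sum y (P - D) \<le> card Q"
    by (simp add: sum_cost_\<W>)
  moreover have "sum y P = sum y D + sum y (P - D)"
    using sum_split_D[of P y] D_sub by (simp add: Int_absorb1)
  moreover have "sum y D \<le> 1"
    using y(2)[OF D(1)] by simp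
  ultimately show "sum y D = 1" "sum y (P - D) = card Q"
    using y(1) by (auto simp: allocations_iff)
qed

section \<open>Families with one simple pair removed\<close>

lemma pair_excess_singleton [simp]: "pair_excess cost y (S, {T}) = cost T - sum y S"
  by (simp add: pair_excess_def)

text \<open>A family that determines the happy nucleolus yields one vector that lies in the core and
  is optimal for the family as well; the next two lemmas lead this to a contradiction.\<close>

lemma determinesE:
  assumes "determines_happy_nucleolus P \<T> cost \<C>"
  obtains y where "happy_nucleolus P \<T> cost y" "core y"
    "lex_maximizer (\<lambda>y. sorted_values (pair_excess cost y) \<C>) (allocations P \<T> cost) y"
  using assms happy_nucleolus_core
  unfolding determines_happy_nucleolus_def pair_excess_vector_def[abs_def] by blast

text \<open>Optimality of \<open>y\<close> forces slack \<open>\<delta>\<close> on each set of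
  \<open>\<W>\<close> containing \<open>q\<close>, and sets of \<open>\<W>\<close> without
  \<open>q\<close> cost 0. Hence \<open>\<W>\<close> bounds the value of \<open>P - D\<close> by
  \<open>1 - \<delta>\<close>, whereas a core vector puts 1 there.\<close>

lemma not_determines_remove_set:
  assumes q: "Q = {q}"
  shows "\<not> determines_happy_nucleolus P \<T> cost (simple_pairs P \<T> - {(D, {D})})"
    (is "\<not> determines_happy_nucleolus _ _ _ ?A")
proof
  assume "determines_happy_nucleolus P \<T> cost ?A"
  then obtain y where core: "core y"
    and max: "lex_maximizer (\<lambda>y. sorted_values (pair_excess cost y) ?A) (allocations P \<T> cost) y"
    by (rule determinesE)
  have y: "y \<in> allocations P \<T> cost" "\<And>T. T \<in> \<T> \<Longrightarrow> sum y T \<le> cost T"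
    using core by (auto simp: core_def)
  define n where "n = real (card D)"
  have n: "1 \<le> n" using card_D by (simp add: n_def)
  \<comment> \<open>Small enough that a subset of \<open>D\<close> with \<open>n - 1\<close>
    elements keeps slack \<open>\<delta>\<close> at \<open>z\<close>: this needs
    \<open>(n - 1) * (1 + \<delta>) \<le> n * (1 - \<delta>)\<close>.\<close>
  define \<delta> where "\<delta> = 1 / (2 * n)"
  have \<delta>: "0 < \<delta>" "\<delta> \<le> 1" using n by (auto simp: \<delta>_def field_simps)
  text \<open>Without the constraint of \<open>D\<close>, moving a little value from \<open>P - D\<close> into \<open>D\<close> makes
    all other tight constraints slack, except for the sets of cost 0.\<close>
  define z where "z p = (if p \<in> D then (1 + \<delta>) / n else if p \<in> P then (1 - \<delta>) * y p else undefined)"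
    for p
  \<comment> \<open>The common part: these sets cost 0, so \<open>y\<close> vanishes on them, and so
    does \<open>z\<close>, which is a multiple of \<open>y\<close> off \<open>D\<close>.\<close>
  define Z where "Z = {(S, {T}) | S T. T \<in> \<T> \<and> S \<subseteq> T \<and> S \<noteq> {} \<and> T \<inter> D = {} \<and> q \<notin> T}"
  have z_out: "sum z S = (1 - \<delta>) * sum y S" if "S \<subseteq> P - D" for S
    unfolding sum_distrib_left using that by (intro sum.cong) (auto simp: z_def)
  have z_in: "sum z S = card S * ((1 + \<delta>) / n)" if "S \<subseteq> D" for S
  proof -
    have "sum z S = (\<Sum>p\<in>S. (1 + \<delta>) / n)"
      using that by (intro sum.cong) (auto simp: z_def)
    then show ?thesis by simp
  qed
  have "sum z P = 2"
    using sum_split_D[of P z] D_sub n z_in[of D] z_out[of "P - D"] core_sums(2)[OF core]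
    D(2) by (simp add: Int_absorb1 q n_def)
  then have z: "z \<in> allocations P \<T> cost"
    using D_sub \<delta> n allocation_nonneg[OF y(1)] unfolding allocations_iff
    by (auto simp: q PiE_iff extensional_def z_def)
  have ge: "\<delta> \<le> pair_excess cost y a" if "a \<in> ?A - Z" for a
  proof (rule lex_maximizer_sorted_values_ge[OF max z _ _ _ _ that])
    show "finite ?A" using finite_simple_pairs[OF set_system] by simp
    show "Z \<subseteq> ?A" using D by (auto simp: Z_def simple_pairs_eq[OF set_system])
    show "pair_excess cost y b = pair_excess cost z b \<and> pair_excess cost z b \<le> \<delta>"
      if bZ: "b \<in> Z" for b
    proof -
      obtain S T where b: "b = (S, {T})" "T \<in> \<T>" "S \<subseteq> T" "T \<inter> D = {}" "q \<notin> T"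
        using bZ by (auto simp: Z_def)
      have "cost T = 0" using b cost_disjoint q by simp
      moreover have "S \<subseteq> P - D" "sum y S \<le> sum y T"
        using b subset_P allocation_sum_mono[OF y(1), of S T] by auto
      moreover have "0 \<le> sum y S"
        using \<open>S \<subseteq> P - D\<close> allocation_nonneg[OF y(1)] by (intro sum_nonneg) auto
      ultimately have "sum y S = 0"
        using y(2)[OF b(2)] by linarith
      then show ?thesis
        using z_out[OF \<open>S \<subseteq> P - D\<close>] \<open>cost T = 0\<close> \<delta> b(1) by simp
    qed
    show "\<delta> \<le> pair_excess cost z b" if bA: "b \<in> ?A - Z" for b
    proof -
      obtain S T where b: "b = (S, {T})" "T \<in> \<T>" "S \<subseteq> T" "S \<noteq> {}"
        using bA by (auto simp: simple_pairs_eq[OF set_system])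
      have TD: "(S, T) \<noteq> (D, D)" "T \<inter> D = {} \<Longrightarrow> q \<in> T"
        using bA b by (auto simp: Z_def)
      consider "T = D" | "T \<noteq> D" "T \<inter> D = {}" | "T \<noteq> D" "T \<inter> D \<noteq> {}" by auto
      then have "\<delta> \<le> cost T - sum z S"
      proof cases
        case 1
        \<comment> \<open>Here the removal of \<open>(D, {D})\<close> enters: that pair has excess
          \<open>- \<delta>\<close> at \<open>z\<close>.\<close>
        have "card S < card D"
          using b TD(1) 1 by (intro psubset_card_mono) auto
        then have "real (card S) \<le> n - 1" by (simp add: n_def)
        then have "sum z S \<le> (n - 1) * ((1 + \<delta>) / n)"
          using z_in[of S] b 1 \<delta> n by (simp add: mult_right_mono divide_right_mono)
        also have "\<dots> \<le> 1 - \<delta>"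
          using n by (simp add: \<delta>_def field_simps)
        finally show ?thesis using 1 by simp
      next
        case 2
        have "cost T = 1" using TD(2) 2 cost_disjoint q by simp
        moreover have "sum y S \<le> sum y T"
          using b subset_P allocation_sum_mono[OF y(1)] by auto
        ultimately have "(1 - \<delta>) * sum y S \<le> (1 - \<delta>) * 1"
          using y(2)[OF b(2)] \<delta> by (intro mult_left_mono) auto
        moreover have "S \<subseteq> P - D" using b 2 subset_P by auto
        ultimately show ?thesis using z_out[of S] \<open>cost T = 1\<close> by simp
      next
        case 3
        have "sum z S \<le> sum z P"
          using b subset_P by (intro allocation_sum_mono[OF z]) auto
        moreover have "cost T = 3" using 3 q unfolding cost_def by simp
        ultimately show ?thesis using \<open>sum z P = 2\<close> \<delta> by simp
      qed
      then show ?thesis by (simp add: b(1))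
    qed
  qed
  have le: "sum y T \<le> (1 - \<delta>) * cost T" if "T \<in> \<W>" for T
  proof (cases "q \<in> T")
    case True
    have "T \<in> \<T>" "T \<inter> D = {}" using that \<W> by auto
    moreover have "(T, {T}) \<in> ?A - Z"
      using True calculation D by (auto simp: Z_def simple_pairs_eq[OF set_system])
    moreover have "cost T = 1"
      using calculation(2) cost_disjoint True q by simp
    ultimately show ?thesis
      using ge[of "(T, {T})"] by simp
  next
    case False
    then have "cost T = 0" using that \<W> cost_disjoint q by simp
    then show ?thesis using y(2) that \<W> by force
  qed
  have "sum y (P - D) \<le> (\<Sum>T\<in>\<W>. sum y T)"
    using allocation_sum_cover y(1) \<W> by blast
  also have "\<dots> \<le> (\<Sum>T\<in>\<W>. (1 - \<delta>) * cost T)"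
    using le by (intro sum_mono)
  also have "\<dots> = 1 - \<delta>"
    using sum_cost_\<W> by (simp add: sum_distrib_left[symmetric] q)
  finally show False
    using core_sums(2)[OF core] \<delta> q by simp
qed

text \<open>At a core vector \<open>y\<close> the pair \<open>(D - {r}, {D})\<close> has excess
  \<open>y r\<close>. Optimality without the pair for \<open>p\<close> drives \<open>y p\<close> to
  0, whereas comparing the happy nucleolus with the uniform vector \<open>dual\<close> gives
  \<open>y p\<close> at least \<open>1 / card D\<close>.\<close>

lemma not_determines_remove_set_minus_point:
  assumes Q_empty: "Q = {}" and p: "p \<in> D" "D - {p} \<noteq> {}"
  shows "\<not> determines_happy_nucleolus P \<T> cost (simple_pairs P \<T> - {(D - {p}, {D})})"
    (is "\<not> determines_happy_nucleolus _ _ _ ?A")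
proof
  assume "determines_happy_nucleolus P \<T> cost ?A"
  then obtain y where happy: "happy_nucleolus P \<T> cost y" and core: "core y"
    and max: "lex_maximizer (\<lambda>y. sorted_values (pair_excess cost y) ?A) (allocations P \<T> cost) y"
    by (rule determinesE)
  define n where "n = real (card D)"
  have "0 < card (D - {p})" using p by (simp add: card_gt_0_iff del: card_Diff_insert)
  then have n: "2 \<le> n" and card_diff: "card (D - {p}) = n - 1"
    using p by (auto simp: n_def card_Diff_singleton of_nat_diff)
  have core_out: "sum x S = 0" if "core x" "S \<subseteq> P" "S \<inter> D = {}" for x S
  proof -
    have x: "x \<in> allocations P \<T> cost" using that by (simp add: core_def)
    have "sum x S \<le> sum x (P - D)"
      using that by (intro allocation_sum_mono[OF x]) auto
    moreover have "0 \<le> sum x S"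
      using that allocation_nonneg[OF x] by (intro sum_nonneg) auto
    ultimately show ?thesis using core_sums(2)[OF that(1)] Q_empty by simp
  qed
  have diff: "sum x (D - {r}) = 1 - x r" if "core x" "r \<in> D" for x r
    using that core_sums(1)[OF that(1)] by (simp add: sum_diff1)
  \<comment> \<open>The unit of value on \<open>D\<close> is spread evenly over
    \<open>D - {p}\<close>, which maximizes the least excess \<open>z r\<close> with
    \<open>r \<noteq> p\<close>.\<close>
  define z where "z r = (if r = p then 0 else if r \<in> D then 1 / (n - 1) else if r \<in> P then 0 else undefined)"
    for r
  have z_D: "sum z D = 1"
  proof -
    have "sum z (D - {p}) = (\<Sum>r\<in>D - {p}. 1 / (n - 1))"
      by (intro sum.cong) (auto simp: z_def)
    also have "\<dots> = 1" using card_diff n by simp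
    finally have "sum z (D - {p}) = 1" .
    moreover have "z p = 0" by (simp add: z_def)
    ultimately show ?thesis using p by (simp add: sum_diff1)
  qed
  have z_out: "sum z S = 0" if "S \<subseteq> P" "S \<inter> D = {}" for S
    using that p by (intro sum.neutral) (auto simp: z_def)
  have z_P: "sum z P = 1"
    using sum_split_D[of P z] D_sub z_D z_out[of "P - D"] by (simp add: Int_absorb1 Diff_Int_distrib2)
  then have z: "z \<in> allocations P \<T> cost"
    using D_sub p n unfolding allocations_iff
    by (auto simp: Q_empty PiE_iff extensional_def z_def)
  \<comment> \<open>The common part: all these pairs have excess 0 at both \<open>y\<close> and
    \<open>z\<close>.\<close>
  define Z where "Z = insert (D, {D}) {(S, {T}) | S T. T \<in> \<T> \<and> S \<subseteq> T \<and> S \<noteq> {} \<and> T \<inter> D = {}}"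
  have ge: "1 / (n - 1) \<le> pair_excess cost y a" if "a \<in> ?A - Z" for a
  proof (rule lex_maximizer_sorted_values_ge[OF max z _ _ _ _ that])
    show "finite ?A" using finite_simple_pairs[OF set_system] by simp
    show "Z \<subseteq> ?A" using D p by (auto simp: Z_def simple_pairs_eq[OF set_system])
    show "pair_excess cost y b = pair_excess cost z b \<and> pair_excess cost z b \<le> 1 / (n - 1)"
      if b: "b \<in> Z" for b
    proof -
      have "pair_excess cost y b = 0 \<and> pair_excess cost z b = 0"
      proof (cases "b = (D, {D})")
        case True
        then show ?thesis using core_sums(1)[OF core] z_D by simp
      next
        case False
        then obtain S T where b: "b = (S, {T})" "T \<in> \<T>" "S \<subseteq> T" "T \<inter> D = {}"
          using b by (auto simp: Z_def)
        then have "S \<subseteq> P" "S \<inter> D = {}" using subset_P by auto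
        then show ?thesis
          unfolding b(1) pair_excess_singleton
          using cost_disjoint[OF b(4)] core_out[OF core] z_out Q_empty by simp
      qed
      then show ?thesis using n by simp
    qed
    show "1 / (n - 1) \<le> pair_excess cost z b" if bA: "b \<in> ?A - Z" for b
    proof -
      obtain S T where b: "b = (S, {T})" "T \<in> \<T>" "S \<subseteq> T" "S \<noteq> {}"
        using bA by (auto simp: simple_pairs_eq[OF set_system])
      have TD: "T \<inter> D \<noteq> {}" "T = D \<Longrightarrow> S \<noteq> D \<and> S \<noteq> D - {p}"
        using bA b by (auto simp: Z_def)
      have "1 / (n - 1) \<le> cost T - sum z S"
      proof (cases "T = D")
        case True
        \<comment> \<open>A proper subset of \<open>D\<close> other than \<open>D - {p}\<close>
          misses some point besides \<open>p\<close>.\<close>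
        then obtain r where r: "r \<in> D" "r \<noteq> p" "S \<subseteq> D - {r}"
          using b(3) TD(2) by blast
        have "sum z S \<le> sum z (D - {r})"
          using r D_sub by (intro allocation_sum_mono[OF z]) auto
        also have "\<dots> = 1 - 1 / (n - 1)"
          proof -
          have "z r = 1 / (n - 1)" using r by (simp add: z_def)
          then show ?thesis using r z_D by (simp add: sum_diff1)
        qed
        finally show ?thesis using True by simp
      next
        case False
        have "sum z S \<le> sum z P"
          using b subset_P by (intro allocation_sum_mono[OF z]) auto
        moreover have "cost T = 2"
          using False TD(1) Q_empty unfolding cost_def by simp
        moreover have "1 / (n - 1) \<le> 1" using n by simp
        ultimately show ?thesis using z_P by simp
      qed
      then show ?thesis by (simp add: b(1))
    qed
  qed
  have y_ge: "1 / (n - 1) \<le> y r" if r: "r \<in> D - {p}" for r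
  proof -
    have "(D - {r}, {D}) \<in> ?A - Z"
      using r p D by (auto simp: Z_def simple_pairs_eq[OF set_system])
    then show ?thesis using ge diff[OF core, of r] r by force
  qed
  \<comment> \<open>The \<open>n - 1\<close> lower bounds already use up the whole value 1 of
    \<open>D\<close>, leaving nothing for \<open>p\<close>.\<close>
  have "(\<Sum>r\<in>D - {p}. 1 / (n - 1)) \<le> sum y (D - {p})"
    using y_ge by (intro sum_mono)
  moreover have "(\<Sum>r\<in>D - {p}. 1 / (n - 1)) = 1"
    using card_diff n by simp
  ultimately have "y p \<le> 0"
    using diff[OF core p(1)] by linarith

  have max': "lex_maximizer (\<lambda>y. sorted_values (excess \<T> cost y) (coalitions P))
      (allocations P \<T> cost) y"
    using happy by (simp add: happy_nucleolus_def excess_vector_def[abs_def])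
  \<comment> \<open>Coalitions whose excess is 0 at every core vector, hence the common part when
    \<open>y\<close> is compared with \<open>dual\<close>.\<close>
  define Z' where "Z' = {S \<in> coalitions P. S \<inter> D = {} \<or> D \<subseteq> S}"
  have tight: "excess \<T> cost x S = 0" if x: "core x" and S: "S \<in> Z'" for x S
  proof -
    have "S \<subseteq> P" using S by (simp add: Z'_def coalitions_def)
    have "excess \<T> cost x S \<le> 0"
    proof (cases "S \<inter> D = {}")
      case True
      then have "covers \<W> S" using \<W>(3) \<open>S \<subseteq> P\<close> by (auto simp: covers_def)
      then have "excess \<T> cost x S \<le> sum cost \<W> - sum x S"
        using \<W>(1) by (intro excess_le) auto
      then show ?thesis
        using core_out[OF x \<open>S \<subseteq> P\<close> True] sum_cost_\<W> Q_empty by simp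
    next
      case False
      then have "S \<inter> D = D" using S by (auto simp: Z'_def)
      then have "sum x S = 1"
        using sum_split_D[OF \<open>S \<subseteq> P\<close>, of x] core_sums(1)[OF x] core_out[OF x, of "S - D"]
          \<open>S \<subseteq> P\<close> by auto
      moreover have "excess \<T> cost x S \<le> sum cost (insert D \<W>) - sum x S"
        using D \<W>(1) covers_insert \<open>S \<subseteq> P\<close> by (intro excess_le) auto
      ultimately show ?thesis
        using sum_cost_insert_\<W> Q_empty by simp
    qed
    then show ?thesis using core_excess_nonneg[OF x \<open>S \<subseteq> P\<close>] by simp
  qed
  have "1 / n \<le> excess \<T> cost y (D - {p})"
  proof (rule lex_maximizer_sorted_values_ge[OF max' dual_allocation finite_coalitions])
    show "Z' \<subseteq> coalitions P" by (auto simp: Z'_def)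
    show "D - {p} \<in> coalitions P - Z'"
      using p D_sub by (auto simp: Z'_def coalitions_def)
    show "excess \<T> cost y S = excess \<T> cost dual S \<and> excess \<T> cost dual S \<le> 1 / n"
      if "S \<in> Z'" for S
      using tight[OF core that] tight[OF core_dual that] n by simp
    show "1 / n \<le> excess \<T> cost dual S" if "S \<in> coalitions P - Z'" for S
    proof -
      have S: "S \<subseteq> P" "S \<inter> D \<noteq> {}" "\<not> D \<subseteq> S"
        using that by (auto simp: Z'_def coalitions_def)
      have "card (S \<inter> D) < card D"
        using S by (intro psubset_card_mono) auto
      then have "real (card (S \<inter> D)) \<le> n - 1" by (simp add: n_def)
      then have "sum dual S \<le> (n - 1) / n"
        using sum_dual[OF S(1)] Q_empty n by (simp add: n_def[symmetric] divide_right_mono)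
      also have "\<dots> = 1 - 1 / n" using n by (simp add: field_simps)
      finally have dual_S: "sum dual S \<le> 1 - 1 / n" .
      show ?thesis
      proof (rule excess_ge[OF set_system S(1)])
        fix \<U> assume \<U>: "\<U> \<subseteq> \<T>" "covers \<U> S"
        \<comment> \<open>As \<open>S\<close> meets \<open>D\<close>, every cover of
          \<open>S\<close> contains a set meeting \<open>D\<close> and so costs at least 1.\<close>
        then obtain T where T: "T \<in> \<U>" "T \<inter> D \<noteq> {}"
          using S(2) unfolding covers_def by blast
        have "cost T \<le> sum cost \<U>"
          using T(1) \<U>(1) cost_nonneg finite_subset[OF _ finite_\<T>] by (intro member_le_sum) auto
        then show "1 / n \<le> sum cost \<U> - sum dual S"
          using cost_ge_1[OF T(2)] dual_S by linarith
      qed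
    qed
  qed
  also have "\<dots> \<le> sum cost {D} - sum y (D - {p})"
    using D by (intro excess_le) (auto simp: covers_def)
  also have "\<dots> = y p"
    using diff[OF core p(1)] by simp
  finally have "1 / n \<le> 0" using \<open>y p \<le> 0\<close> by linarith
  then show False using n by (simp add: divide_le_0_iff)
qed

end

section \<open>Choice of the cover and conclusion\<close>

text \<open>In an inclusion-minimal cover, dropping any set \<open>T\<close> leaves some
  \<open>q\<close> uncovered. Such a \<open>q\<close> lies in exactly one set of the cover, as
  \<open>split_instance\<close> with \<open>Q = {q}\<close> demands.\<close>

lemma minimal_cover_private_element:
  assumes "finite \<U>" "covers \<U> S" "S \<noteq> {}"
  obtains \<W> T q where "\<W> \<subseteq> \<U>" "covers \<W> S" "T \<in> \<W>" "q \<in> S \<inter> T" "q \<notin> \<Union>(\<W> - {T})"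
proof -
  define F where "F = {\<W>. \<W> \<subseteq> \<U> \<and> covers \<W> S}"
  have "finite F" "F \<noteq> {}"
    using assms by (auto simp: F_def)
  then obtain \<W> where "\<W> \<in> F" and min: "\<forall>\<V>\<in>F. \<V> \<subseteq> \<W> \<longrightarrow> \<W> = \<V>"
    using finite_has_minimal by metis
  then have \<W>: "\<W> \<subseteq> \<U>" "covers \<W> S"
    by (auto simp: F_def)
  obtain T where T: "T \<in> \<W>"
    using \<W>(2) assms(3) by (auto simp: covers_def)
  have "\<W> - {T} \<notin> F"
    using min T by blast
  then have "\<not> covers (\<W> - {T}) S"
    using \<W>(1) by (auto simp: F_def)
  then obtain q where "q \<in> S" "q \<notin> \<Union>(\<W> - {T})"
    by (auto simp: covers_def)
  moreover have "q \<in> T"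
    using calculation \<W>(2) by (auto simp: covers_def)
  ultimately show ?thesis
    using that[OF \<W> T] by simp
qed

theorem theorem2:
  fixes P :: "'a set" and \<T> :: "'a set set"
  assumes "set_system P \<T>"
    and "complement_condition P \<T>"
  shows "\<forall>(S, \<U>) \<in> star_pairs P \<T>. \<exists>c :: 'a set \<Rightarrow> real.
           set_covering_instance P \<T> c \<and>
           \<not> determines_happy_nucleolus P \<T> c (simple_pairs P \<T> - {(S, \<U>)})"
proof clarify
  fix S \<U>
  assume "(S, \<U>) \<in> star_pairs P \<T>"
  then obtain T where T: "T \<in> \<T>" "\<U> = {T}" "S \<noteq> {}" "S \<noteq> P"
    and S: "S = T \<or> (\<exists>p\<in>T. S = T - {p})"
    by (auto simp: star_pairs_def)
  have fin: "finite \<T>" "T \<subseteq> P"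
    using assms(1) T(1) by (auto simp: set_system_def dest: finite_subset)
  obtain \<V> where "\<V> \<subseteq> \<T> \<inter> Pow (P - T)" and cov: "covers \<V> (P - T)"
    using assms(2) T(1) unfolding complement_condition_def by metis
  then have \<V>: "\<V> \<subseteq> \<T>" "\<And>V. V \<in> \<V> \<Longrightarrow> V \<inter> T = {}"
    by auto
  have "finite \<V>" using \<V>(1) fin(1) by (rule finite_subset)
  show "\<exists>c :: 'a set \<Rightarrow> real. set_covering_instance P \<T> c \<and>
      \<not> determines_happy_nucleolus P \<T> c (simple_pairs P \<T> - {(S, \<U>)})"
  proof (cases "S = T")
    case True
    \<comment> \<open>Star pairs exclude \<open>S = P\<close>, so there is a complement from which
      to choose \<open>q\<close>.\<close>
    have "P - T \<noteq> {}" using True T(4) fin(2) by auto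
    then obtain \<W> W q where W: "\<W> \<subseteq> \<V>" "covers \<W> (P - T)" "W \<in> \<W>"
      "q \<in> (P - T) \<inter> W" "q \<notin> \<Union>(\<W> - {W})"
      using minimal_cover_private_element[OF \<open>finite \<V>\<close> cov] by metis
    have "finite \<W>" using W(1) \<open>finite \<V>\<close> by (rule finite_subset)
    have "(\<Sum>V\<in>\<W>. card (V \<inter> {q})) = (\<Sum>V\<in>\<W>. if V = W then 1 else 0)"
      using W(4,5) by (intro sum.cong) auto
    then have "(\<Sum>V\<in>\<W>. card (V \<inter> {q})) = card {q}"
      using W(3) \<open>finite \<W>\<close> by simp
    then interpret split_instance P \<T> T "{q}" \<W>
    proof unfold_locales
      show "\<W> \<subseteq> \<T>" using W(1) \<V>(1) by simp
      show "V \<inter> T = {}" if "V \<in> \<W>" for V using that W(1) \<V>(2) by blast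
    qed (use assms(1) T True W(2,4) in auto)
    show ?thesis
      using covering_instance not_determines_remove_set True T(2) by blast
  next
    case False
    then obtain p where p: "p \<in> T" "S = T - {p}" using S by blast
    \<comment> \<open>For empty \<open>Q\<close> all intersection sizes vanish, so the cover from
      the complement condition serves without passing to a minimal one.\<close>
    interpret split_instance P \<T> T "{}" \<V>
      using assms(1) T(1) p(1) \<V> cov by unfold_locales auto
    show ?thesis
      using covering_instance not_determines_remove_set_minus_point[of p] p T by blast
  qed
qed

end
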